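(* There exist Slitherlink signatures of multiplicity $3$ on arbitrarily large square grids; that is, for every positive integer $n_0$ there exist an integer $n \ge n_0$ and a cycle $C$ in the $n \times n$ grid such that exactly $3$ cycles in the $n \times n$ grid (including $C$ itself) have the same signature as $C$.
   Context: The $n \times n$ grid is the plane graph whose vertices are the integer points $(x, y)$ with $1 \le x \le n$ and $1 \le y \le n$ and whose edges are the unit segments between these points; its finite faces are the unit square cells. The signature of a cycle $C$ on the grid (also called a Slitherlink signature) is the function assigning to each cell the number of edges of that cell which belong to $C$. The multiplicity of a signature $S$ is the total number of cycles on the grid whose signature is $S$. *)

theory Defs
  imports Main "HOL-Library.FuncSet"
begin

type_synonym point = "int \<times> int"

definition grid_vertices :: "nat \<Rightarrow> point set" where
  "grid_vertices n = {1..int n} \<times> {1..int n}"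

(* An undirected edge is the two-element set of its endpoints. *)
definition grid_edges :: "nat \<Rightarrow> point set set" where
  "grid_edges n = {{u, v} | u v. u \<in> grid_vertices n \<and> v \<in> grid_vertices n \<and>
                      \<bar>fst u - fst v\<bar> + \<bar>snd u - snd v\<bar> = 1}"

definition closed_walk_edges :: "'a list \<Rightarrow> 'a set set" where
  "closed_walk_edges p = {{p ! i, p ! (Suc i mod length p)} | i. i < length p}"

(* A cycle is identified with its edge set, so the starting vertex and the direction of
   traversal do not matter when cycles are counted. *)
definition grid_cycle :: "nat \<Rightarrow> point set set \<Rightarrow> bool" where
  "grid_cycle n C \<longleftrightarrow>
     C \<subseteq> grid_edges n \<and> (\<exists>p. 3 \<le> length p \<and> distinct p \<and> C = closed_walk_edges p)"

(* A cell is represented by its lower left corner. *)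
definition grid_cells :: "nat \<Rightarrow> point set" where
  "grid_cells n = {1..<int n} \<times> {1..<int n}"

fun cell_edges :: "point \<Rightarrow> point set set" where
  "cell_edges (x, y) =
     {{(x, y), (x + 1, y)}, {(x, y + 1), (x + 1, y + 1)},
      {(x, y), (x, y + 1)}, {(x + 1, y), (x + 1, y + 1)}}"

(* The restriction to the cells makes equality of signatures mean agreement on every cell. *)
definition signature :: "nat \<Rightarrow> point set set \<Rightarrow> point \<Rightarrow> nat" where
  "signature n C = (\<lambda>c\<in>grid_cells n. card (cell_edges c \<inter> C))"

definition sig_multiplicity :: "nat \<Rightarrow> (point \<Rightarrow> nat) \<Rightarrow> nat" where
  "sig_multiplicity n S = card {C. grid_cycle n C \<and> signature n C = S}"

end

theory Submission
  imports Defs "HOL-Library.Multiset" "HOL-Library.Product_Lexorder"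
begin

text \<open>The three cycles are the boundaries of three snakes (paths of unit cells) that wind along the main
  diagonal of the grid of side \<open>n = 4 k + 4\<close> with period \<open>(4, 4)\<close>.  Their signatures agree on the ends
  and on one period, hence everywhere.

  Conversely, a cycle is determined by its signature and by its edges on the bottom side of the grid:
  sweeping upwards, the parity of the degrees gives the vertical edges of a row and the clues then give
  the horizontal edges above.  The clues vanish on the bottom row from the ninth cell on, and the
  clues near the lower left corner leave only three possibilities for the first eight edges.\<close>

section \<open>Cycles, degrees and clues\<close>

text \<open>The upper bound works with local constraints alone: degree 0 or 2 at each vertex and one
  clue per cell. Near the corner these fix six of the first eight bottom edges and exclude one of
  the four combinations of the other two; this is where the number 3 comes from. The obstacle on the
  other side is that the circuits grow with \<open>k\<close>, so they cannot simply be evaluated.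
  They are handled as multisets of directed edges: the order of traversal affects neither the
  distinctness of the vertices nor the number of edges around a cell, and the multiset splits into
  translates of a fixed finite piece. Each claim for all \<open>k\<close> thus reduces to claims
  about one head, one period and one cap, which evaluation settles.\<close>

lemma cycle_degree:
  assumes "distinct p" "3 \<le> length p"
  shows "card {e \<in> closed_walk_edges p. w \<in> e} \<in> {0, 2}"
proof (cases "w \<in> set p")
  case False
  have "{e \<in> closed_walk_edges p. w \<in> e} = {}"
  proof -
    have "p ! (Suc i mod length p) \<in> set p" if "i < length p" for i
      using that by (intro nth_mem mod_less_divisor) linarith
    then show ?thesis using False by (auto simp: closed_walk_edges_def)
  qed
  then have "card {e \<in> closed_walk_edges p. w \<in> e} = 0" by (simp only: card.empty)
  then show ?thesis by simp
next
  case True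
  define L where "L = length p"
  have L3: "3 \<le> L" using assms(2) by (simp add: L_def)
  obtain i where i: "i < L" "w = p ! i" using True by (auto simp: in_set_conv_nth L_def)
  define j where "j = (if i = 0 then L - 1 else i - 1)"
  define i' where "i' = Suc i mod L"
  have j: "j < L" and i': "i' < L" using i L3 by (auto simp: j_def i'_def)
  have inj: "p ! u = p ! v \<longleftrightarrow> u = v" if "u < L" "v < L" for u v
    using assms(1) that by (simp add: L_def nth_eq_iff_index_eq)
  have succ: "Suc u mod L = i \<longleftrightarrow> u = j" if "u < L" for u
    using that i(1) L3 by (cases "Suc u = L") (auto simp: j_def)
  \<comment> \<open>Cyclic predecessor \<open>j\<close> and successor \<open>i'\<close> of
    \<open>i\<close> differ because the length is at least 3; so the two edges at \<open>w\<close>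
    are different.\<close>
  have ne: "i' \<noteq> j" "i \<noteq> j" "i' \<noteq> i"
    using i(1) L3 by (auto simp: j_def i'_def mod_Suc)
  have eq: "{e \<in> closed_walk_edges p. w \<in> e} = {{p ! i, p ! i'}, {p ! j, p ! i}}" (is "?X = ?Y")
  proof
    show "?X \<subseteq> ?Y"
    proof
      fix e assume "e \<in> ?X"
      then obtain u where u: "u < L" "e = {p ! u, p ! (Suc u mod L)}" "p ! i \<in> e"
        by (auto simp: closed_walk_edges_def L_def i)
      have "Suc u mod L < L" using u(1) by simp
      with u i(1) have "i = u \<or> Suc u mod L = i" by (auto simp: inj)
      then show "e \<in> ?Y" using succ[OF u(1)] u by (auto simp: i'_def)
    qed
    have "Suc j mod L = i" using succ[OF j] by simp
    then show "?Y \<subseteq> ?X" using i j by (auto simp: closed_walk_edges_def i'_def L_def)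
  qed
  have "{p ! i, p ! i'} \<noteq> {p ! j, p ! i}"
    using ne i(1) j i' by (auto simp: doubleton_eq_iff inj)
  then have "card {e \<in> closed_walk_edges p. w \<in> e} = 2" by (simp add: eq)
  then show ?thesis by simp
qed

section \<open>Edge sets as Boolean variables, degrees and clues as sums\<close>

definition hor :: "point set set \<Rightarrow> int \<Rightarrow> int \<Rightarrow> bool" where
  "hor C x y \<longleftrightarrow> {(x, y), (x + 1, y)} \<in> C"

definition ver :: "point set set \<Rightarrow> int \<Rightarrow> int \<Rightarrow> bool" where
  "ver C x y \<longleftrightarrow> {(x, y), (x, y + 1)} \<in> C"

text \<open>The degree of a vertex. For \<open>C\<close> inside the grid, edges that would leave the
  grid contribute 0, so border vertices need no separate formula.\<close>

definition vertex_sum :: "point set set \<Rightarrow> int \<Rightarrow> int \<Rightarrow> nat" where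
  "vertex_sum C x y =
     of_bool (hor C (x - 1) y) + of_bool (hor C x y) + of_bool (ver C x (y - 1)) + of_bool (ver C x y)"

definition cell_sum :: "point set set \<Rightarrow> int \<Rightarrow> int \<Rightarrow> nat" where
  "cell_sum C x y =
     of_bool (hor C x y) + of_bool (hor C x (y + 1)) + of_bool (ver C x y) + of_bool (ver C (x + 1) y)"

lemma card_four_Int:
  assumes "distinct [a, b, c, d]"
  shows "card ({a, b, c, d} \<inter> C) = of_bool (a \<in> C) + of_bool (b \<in> C) + of_bool (c \<in> C) + of_bool (d \<in> C)"
  using assms
  by (cases "a \<in> C"; cases "b \<in> C"; cases "c \<in> C"; cases "d \<in> C") simp_all

lemma grid_edge_cases:
  assumes "e \<in> grid_edges n"
  obtains x y where "e = {(x, y), (x + 1, y)}" "1 \<le> x" "x < int n" "1 \<le> y" "y \<le> int n"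
  | x y where "e = {(x, y), (x, y + 1)}" "1 \<le> x" "x \<le> int n" "1 \<le> y" "y < int n"
proof -
  obtain a b c d where e: "e = {(a, b), (c, d)}"
    and in_grid: "1 \<le> a" "a \<le> int n" "1 \<le> b" "b \<le> int n" "1 \<le> c" "c \<le> int n" "1 \<le> d" "d \<le> int n"
    and "\<bar>a - c\<bar> + \<bar>b - d\<bar> = 1"
    using assms by (auto simp: grid_edges_def grid_vertices_def)
  then consider "b = d" "c = a + 1" | "b = d" "a = c + 1" | "a = c" "d = b + 1" | "a = c" "b = d + 1"
    by linarith
  then show thesis
    using in_grid that e by cases (auto simp: insert_commute)
qed

lemma hor_in_grid:
  assumes "C \<subseteq> grid_edges n" "hor C x y"
  shows "1 \<le> x" "x < int n" "1 \<le> y" "y \<le> int n"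
proof -
  have "{(x, y), (x + 1, y)} \<in> grid_edges n" using assms by (auto simp: hor_def)
  then show "1 \<le> x" "x < int n" "1 \<le> y" "y \<le> int n"
    by (cases rule: grid_edge_cases, auto simp: doubleton_eq_iff)+
qed

lemma ver_in_grid:
  assumes "C \<subseteq> grid_edges n" "ver C x y"
  shows "1 \<le> x" "x \<le> int n" "1 \<le> y" "y < int n"
proof -
  have "{(x, y), (x, y + 1)} \<in> grid_edges n" using assms by (auto simp: ver_def)
  then show "1 \<le> x" "x \<le> int n" "1 \<le> y" "y < int n"
    by (cases rule: grid_edge_cases, auto simp: doubleton_eq_iff)+
qed

lemma edge_set_eqI:
  assumes "C \<subseteq> grid_edges n" "C' \<subseteq> grid_edges n"
    and "\<And>x y. hor C x y = hor C' x y" "\<And>x y. ver C x y = ver C' x y"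
  shows "C = C'"
proof -
  have "e \<in> C \<longleftrightarrow> e \<in> C'" if "e \<in> grid_edges n" for e
    using that assms(3,4) by (cases rule: grid_edge_cases) (auto simp: hor_def ver_def)
  then show ?thesis using assms(1,2) by blast
qed

lemma vertex_sum_eq_card:
  assumes "C \<subseteq> grid_edges n"
  shows "vertex_sum C x y = card {e \<in> C. (x, y) \<in> e}"
proof -
  have "{e \<in> C. (x, y) \<in> e} =
    {{(x - 1, y), (x, y)}, {(x, y), (x + 1, y)}, {(x, y - 1), (x, y)}, {(x, y), (x, y + 1)}} \<inter> C"
    (is "?X = ?Y \<inter> C")
  proof -
    have "e \<in> ?Y" if "e \<in> C" "(x, y) \<in> e" for e
    proof -
      have "e \<in> grid_edges n" using that assms by blast
      then show ?thesis
      proof (cases rule: grid_edge_cases)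
        case (1 a b)
        then have "x = a \<and> y = b \<or> x = a + 1 \<and> y = b" using that(2) by simp
        with 1(1) have "e = {(x, y), (x + 1, y)} \<or> e = {(x - 1, y), (x, y)}" by fastforce
        then show ?thesis by blast
      next
        case (2 a b)
        then have "x = a \<and> y = b \<or> x = a \<and> y = b + 1" using that(2) by simp
        with 2(1) have "e = {(x, y), (x, y + 1)} \<or> e = {(x, y - 1), (x, y)}" by fastforce
        then show ?thesis by blast
      qed
    qed
    moreover have "(x, y) \<in> e" if "e \<in> ?Y" for e
      using that by (elim insertE emptyE) simp_all
    ultimately show ?thesis by (intro equalityI subsetI IntI CollectI conjI) (simp_all only: mem_Collect_eq Int_iff)
  qed
  then have "card {e \<in> C. (x, y) \<in> e} = card (?Y \<inter> C)" by (rule arg_cong)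
  also have "\<dots> = vertex_sum C x y"
    by (subst card_four_Int) (simp_all add: doubleton_eq_iff vertex_sum_def hor_def ver_def)
  finally show ?thesis by (rule sym)
qed

lemma grid_cycle_vertex_sum:
  assumes "grid_cycle n C"
  shows "vertex_sum C x y \<in> {0, 2}"
proof -
  have "C \<subseteq> grid_edges n" using assms by (simp add: grid_cycle_def)
  then show ?thesis
    using assms cycle_degree unfolding vertex_sum_eq_card[OF \<open>C \<subseteq> grid_edges n\<close>] grid_cycle_def
    by metis
qed

lemma signature_eq_cell_sum:
  assumes "(x, y) \<in> grid_cells n"
  shows "signature n C (x, y) = cell_sum C x y"
proof -
  have "signature n C (x, y) = card (cell_edges (x, y) \<inter> C)"
    using assms by (simp add: signature_def)
  also have "\<dots> = cell_sum C x y"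
    unfolding cell_edges.simps
    by (subst card_four_Int) (simp_all add: doubleton_eq_iff cell_sum_def hor_def ver_def)
  finally show ?thesis .
qed

text \<open>Evenness is a linear equation modulo 2, and a chain of three equivalences is the parity
  of three truth values; the equation is solved here for the upper edge, as the upward sweep
  requires.\<close>

lemma even_vertex_sum_iff:
  "even (vertex_sum C x y) \<longleftrightarrow>
     (ver C x y \<longleftrightarrow> (hor C (x - 1) y \<longleftrightarrow> hor C x y \<longleftrightarrow> ver C x (y - 1)))"
  unfolding vertex_sum_def
  by (cases "hor C (x - 1) y"; cases "hor C x y"; cases "ver C x (y - 1)"; cases "ver C x y") simp_all

text \<open>Sweeping upwards, the degree parity at a vertex determines the edge above it, and the clue
  of a cell then determines its top edge.\<close>
lemma edge_set_determined_by_bottom_row: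
  assumes C: "C \<subseteq> grid_edges n" and C': "C' \<subseteq> grid_edges n"
    and even: "\<And>x y. even (vertex_sum C x y)" and even': "\<And>x y. even (vertex_sum C' x y)"
    and cells: "\<And>x y. (x, y) \<in> grid_cells n \<Longrightarrow> cell_sum C x y = cell_sum C' x y"
    and bottom: "\<And>x. hor C x 1 = hor C' x 1"
  shows "C = C'"
proof -
  \<comment> \<open>The invariant pairs the horizontal edges at height \<open>m + 1\<close> with the
    vertical edges just below them. At \<open>m = 0\<close> the latter lie outside the grid, so only
    the bottom row has to be given.\<close>
  have row: "\<forall>x. hor C x (int m + 1) = hor C' x (int m + 1) \<and> ver C x (int m) = ver C' x (int m)" for m
  proof (induction m)
    case 0
    have "\<not> ver C x 0" "\<not> ver C' x 0" for x
      using ver_in_grid(3)[OF C, of x 0] ver_in_grid(3)[OF C', of x 0] by auto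
    then show ?case using bottom by simp
  next
    case (Suc m)
    define y where "y = int m + 1"
    have v: "ver C x y = ver C' x y" for x
      using even[of x y] even'[of x y] Suc.IH by (simp add: even_vertex_sum_iff y_def)
    have h: "hor C x (y + 1) = hor C' x (y + 1)" for x
    proof (cases "(x, y) \<in> grid_cells n")
      case True
      show ?thesis
        using cells[OF True] v[of x] v[of "x + 1"] Suc.IH by (simp add: cell_sum_def y_def of_bool_eq_iff)
    next
      case False
      then show ?thesis
        using hor_in_grid[OF C, of x "y + 1"] hor_in_grid[OF C', of x "y + 1"]
        by (auto simp: grid_cells_def y_def)
    qed
    show ?case using v h by (simp add: y_def add.commute)
  qed
  show ?thesis
  proof (rule edge_set_eqI[OF C C'])
    fix x y
    show "hor C x y = hor C' x y"
    proof (cases "1 \<le> y")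
      case True
      then show ?thesis using row[of "nat (y - 1)"] by simp
    next
      case False
      then show ?thesis using hor_in_grid(3)[OF C, of x y] hor_in_grid(3)[OF C', of x y] by blast
    qed
    show "ver C x y = ver C' x y"
    proof (cases "1 \<le> y")
      case True
      then show ?thesis using row[of "nat y"] by simp
    next
      case False
      then show ?thesis using ver_in_grid(3)[OF C, of x y] ver_in_grid(3)[OF C', of x y] by blast
    qed
  qed
qed

section \<open>Closed walks\<close>

text \<open>A word of directions carries no position, so the same period can be replayed from any
  translate of its starting point.\<close>

datatype dir = U | D | L | R

fun move :: "dir \<Rightarrow> point \<Rightarrow> point" where
  "move U (x, y) = (x, y + 1)"
| "move D (x, y) = (x, y - 1)"
| "move L (x, y) = (x - 1, y)"
| "move R (x, y) = (x + 1, y)"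

type_synonym dart = "point \<times> point"

fun darts :: "point \<Rightarrow> dir list \<Rightarrow> dart list" where
  "darts s [] = []"
| "darts s (d # w) = (s, move d s) # darts (move d s) w"

fun edge_of :: "dart \<Rightarrow> point set" where
  "edge_of (u, v) = {u, v}"

fun shift :: "int \<Rightarrow> point \<Rightarrow> point" where
  "shift t (x, y) = (x + t, y + t)"

abbreviation shift_dart :: "int \<Rightarrow> dart \<Rightarrow> dart" where
  "shift_dart t \<equiv> map_prod (shift t) (shift t)"

lemma shift_shift [simp]: "shift s (shift t u) = shift (s + t) u"
  by (cases u) simp

lemma shift_0 [simp]: "shift 0 = id"
  by auto

lemma inj_shift: "inj (shift t)"
  by (auto simp: inj_def)

lemma fst_shift [simp]: "fst (shift t u) = fst u + t" and snd_shift [simp]: "snd (shift t u) = snd u + t"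
  by (cases u; simp)+

lemma move_shift: "move d (shift t u) = shift t (move d u)"
  by (cases d; cases u) simp_all

lemma fold_move_shift: "fold move w (shift t u) = shift t (fold move w u)"
  by (induction w arbitrary: u) (simp_all add: move_shift)

lemma darts_append: "darts s (v @ w) = darts s v @ darts (fold move v s) w"
  by (induction v arbitrary: s) simp_all

lemma darts_shift: "darts (shift t s) w = map (shift_dart t) (darts s w)"
  by (induction w arbitrary: s) (simp_all add: move_shift)

lemma length_darts [simp]: "length (darts s w) = length w"
  by (induction w arbitrary: s) simp_all

lemma darts_nth:
  "i < length w \<Longrightarrow> darts s w ! i = (fold move (take i w) s, fold move (take (Suc i) w) s)"
  by (induction w arbitrary: s i) (auto simp: nth_Cons split: nat.split)

lemma closed_walk_edges_darts:
  assumes "fold move w s = s"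
  shows "closed_walk_edges (map fst (darts s w)) = edge_of ` set (darts s w)"
proof -
  have "fst (darts s w ! (Suc i mod length w)) = snd (darts s w ! i)" if "i < length w" for i
  proof (cases "Suc i < length w")
    case True
    then show ?thesis using that by (simp add: darts_nth)
  next
    \<comment> \<open>The index wraps around to 0 here, and the last dart ends at the start
      \<open>s\<close> because the walk is closed.\<close>
    case False
    with that have "length w = Suc i" by simp
    then show ?thesis using assms that by (simp add: darts_nth)
  qed
  then have "{fst (darts s w ! i), fst (darts s w ! (Suc i mod length w))} = edge_of (darts s w ! i)"
    if "i < length w" for i
    using that by (metis edge_of.simps prod.collapse)
  moreover have "Suc i mod length w < length w" if "i < length w" for i
    using that by (intro mod_less_divisor) linarith
  ultimately have "closed_walk_edges (map fst (darts s w)) = {edge_of (darts s w ! i) |i. i < length w}"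
    unfolding closed_walk_edges_def by (auto; metis nth_map length_darts)
  also have "\<dots> = edge_of ` set (darts s w)"
    by (auto simp: set_conv_nth)
  finally show ?thesis .
qed

text \<open>Two different darts on one edge would be opposite to each other, so each would be the
  cyclic successor of the other and the walk would have length 2.\<close>

lemma inj_on_edge_of_darts:
  assumes "fold move w s = s" "distinct (map fst (darts s w))" "3 \<le> length w"
  shows "inj_on edge_of (set (darts s w))"
proof -
  define p where "p = map fst (darts s w)"
  define n where "n = length w"
  have p: "p ! i = p ! j \<longleftrightarrow> i = j" if "i < n" "j < n" for i j
    using that assms(2) nth_eq_iff_index_eq[of "map fst (darts s w)" i j] by (simp add: p_def n_def)
  have n: "3 \<le> n" using assms(3) by (simp add: n_def)
  have dart: "darts s w ! i = (p ! i, p ! (Suc i mod n))" if "i < n" for i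
  proof (cases "Suc i < n")
    case True
    then show ?thesis using that by (simp add: p_def n_def darts_nth)
  next
    case False
    with that have "n = Suc i" by simp
    then show ?thesis using assms(1) that n by (simp add: p_def n_def darts_nth)
  qed
  have "i = j" if i: "i < n" and j: "j < n" and eq: "edge_of (darts s w ! i) = edge_of (darts s w ! j)" for i j
  proof (rule ccontr)
    assume "i \<noteq> j"
    moreover have "Suc i mod n < n" "Suc j mod n < n" using n by simp_all
    ultimately have "Suc i mod n = j" "Suc j mod n = i"
      using i j eq by (auto simp: dart doubleton_eq_iff p)
    then show False
      using i j n \<open>i \<noteq> j\<close> by (auto simp: mod_Suc split: if_splits)
  qed
  then show ?thesis
    by (intro inj_onI) (metis in_set_conv_nth length_darts n_def)
qed

section \<open>Clues of a closed walk as multiplicities of cells\<close>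

fun dart_cells :: "dart \<Rightarrow> point list" where
  "dart_cells ((x, y), (x', y')) =
     (if y = y' then [(min x x', y), (min x x', y - 1)] else [(x, min y y'), (x - 1, min y y')])"

lemma dart_cells_shift: "dart_cells (shift_dart t d) = map (shift t) (dart_cells d)"
  by (cases d rule: dart_cells.cases) (auto simp: min_def)

lemma hor_edge_in_cell:
  "{(x, y), (x + 1, y)} \<in> cell_edges c \<longleftrightarrow> c = (x, y) \<or> c = (x, y - 1)"
proof -
  obtain a b where c: "c = (a, b)" by (cases c)
  have "{(x, y), (x + 1, y)} \<in> cell_edges c \<longleftrightarrow> a = x \<and> b = y \<or> a = x \<and> b + 1 = y"
    unfolding c cell_edges.simps insert_iff empty_iff doubleton_eq_iff prod.inject
    by (rule iffI; elim disjE conjE; simp)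
  also have "\<dots> \<longleftrightarrow> c = (x, y) \<or> c = (x, y - 1)"
    unfolding c prod.inject by (simp add: eq_diff_eq eq_commute)
  finally show ?thesis .
qed

lemma ver_edge_in_cell:
  "{(x, y), (x, y + 1)} \<in> cell_edges c \<longleftrightarrow> c = (x, y) \<or> c = (x - 1, y)"
proof -
  obtain a b where c: "c = (a, b)" by (cases c)
  have "{(x, y), (x, y + 1)} \<in> cell_edges c \<longleftrightarrow> a = x \<and> b = y \<or> a + 1 = x \<and> b = y"
    unfolding c cell_edges.simps insert_iff empty_iff doubleton_eq_iff prod.inject
    by (rule iffI; elim disjE conjE; simp)
  also have "\<dots> \<longleftrightarrow> c = (x, y) \<or> c = (x - 1, y)"
    unfolding c prod.inject by (simp add: eq_diff_eq eq_commute)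
  finally show ?thesis .
qed

lemma dart_cells_step:
  "distinct (dart_cells (u, move d u))"
  "edge_of (u, move d u) \<in> cell_edges c \<longleftrightarrow> c \<in> set (dart_cells (u, move d u))"
proof -
  obtain x y where u: "u = (x, y)" by (cases u)
  show "distinct (dart_cells (u, move d u))"
    by (cases d) (simp_all add: u)
  show "edge_of (u, move d u) \<in> cell_edges c \<longleftrightarrow> c \<in> set (dart_cells (u, move d u))"
  proof (cases d)
    case U
    then show ?thesis using ver_edge_in_cell[of x y c] by (simp add: u)
  next
    case D
    have "{(x, y), (x, y - 1)} = {(x, y - 1), (x, y - 1 + 1)}" by (simp add: insert_commute)
    then show ?thesis using D ver_edge_in_cell[of x "y - 1" c] by (simp add: u)
  next
    case L
    have "{(x, y), (x - 1, y)} = {(x - 1, y), (x - 1 + 1, y)}" by (simp add: insert_commute)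
    then show ?thesis using L hor_edge_in_cell[of "x - 1" y c] by (simp add: u)
  next
    case R
    then show ?thesis using hor_edge_in_cell[of x y c] by (simp add: u)
  qed
qed

lemma in_darts_step: "(u, v) \<in> set (darts s w) \<Longrightarrow> \<exists>d. v = move d u"
proof (induction w arbitrary: s)
  case (Cons a w)
  then show ?case using Cons.IH[of "move a s"] by (simp del: split_paired_Ex) blast
qed simp

text \<open>Each dart contributes the two cells on its sides, including cells outside the grid. The
  multiplicity of a cell is then its clue, and comparing signatures becomes comparing multisets, on
  which translations act by \<open>image_mset\<close>.\<close>

definition walk_cells :: "dart list \<Rightarrow> point multiset" where
  "walk_cells ds = mset (concat (map dart_cells ds))"

lemma walk_cells_simps [simp]:
  "walk_cells [] = {#}"
  "walk_cells (d # ds) = mset (dart_cells d) + walk_cells ds"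
  by (simp_all add: walk_cells_def)

lemma walk_cells_append [simp]: "walk_cells (ds @ ds') = walk_cells ds + walk_cells ds'"
  by (simp add: walk_cells_def)

lemma walk_cells_shift: "walk_cells (map (shift_dart t) ds) = image_mset (shift t) (walk_cells ds)"
  by (induction ds) (simp_all add: dart_cells_shift del: dart_cells.simps)

lemma walk_cells_cong: "mset ds = mset ds' \<Longrightarrow> walk_cells ds = walk_cells ds'"
  by (simp add: walk_cells_def mset_concat flip: sum_mset_sum_list)

text \<open>Double counting: darts correspond to edges injectively, and a dart lists a given cell at
  most once since its two sides are different cells.\<close>

lemma signature_eq_count:
  assumes closed: "fold move w s = s" and dist: "distinct (map fst (darts s w))" and len: "3 \<le> length w"
    and c: "c \<in> grid_cells n"
  shows "signature n (closed_walk_edges (map fst (darts s w))) c = count (walk_cells (darts s w)) c"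
proof -
  let ?ds = "darts s w"
  have step: "distinct (dart_cells d)" "edge_of d \<in> cell_edges c \<longleftrightarrow> c \<in> set (dart_cells d)"
    if d: "d \<in> set ?ds" for d
  proof -
    obtain u v where "d = (u, v)" by (cases d)
    moreover from this obtain e where "v = move e u" using d in_darts_step by blast
    ultimately show "distinct (dart_cells d)" "edge_of d \<in> cell_edges c \<longleftrightarrow> c \<in> set (dart_cells d)"
      using dart_cells_step by blast+
  qed
  have "signature n (closed_walk_edges (map fst ?ds)) c = card (cell_edges c \<inter> edge_of ` set ?ds)"
    using c by (simp add: signature_def closed_walk_edges_darts[OF closed])
  also have "cell_edges c \<inter> edge_of ` set ?ds = edge_of ` {d \<in> set ?ds. c \<in> set (dart_cells d)}"
    using step by blast
  also have "card \<dots> = card {d \<in> set ?ds. c \<in> set (dart_cells d)}"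
    by (intro card_image inj_on_subset[OF inj_on_edge_of_darts[OF closed dist len]]) blast
  also have "\<dots> = (\<Sum>d\<in>set ?ds. count (mset (dart_cells d)) c)"
  proof -
    have "count (mset (dart_cells d)) c = of_bool (c \<in> set (dart_cells d))" if "d \<in> set ?ds" for d
      using step(1)[OF that] unfolding distinct_count_atmost_1 by (metis of_bool_def)
    then show ?thesis by (simp add: Int_def)
  qed
  also have "\<dots> = (\<Sum>d\<leftarrow>?ds. count (mset (dart_cells d)) c)"
    using dist by (simp add: sum_list_distinct_conv_sum_set distinct_map)
  also have "\<dots> = count (walk_cells ?ds) c"
  proof -
    have "(\<Sum>d\<leftarrow>ds. count (mset (dart_cells d)) c) = count (walk_cells ds) c" for ds
      by (induction ds) simp_all
    then show ?thesis .
  qed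
  finally show ?thesis .
qed

section \<open>Closed walks with a periodic part\<close>

fun opp :: "dir \<Rightarrow> dir" where
  "opp U = D" | "opp D = U" | "opp L = R" | "opp R = L"

definition reverse_word :: "dir list \<Rightarrow> dir list" where
  "reverse_word w = rev (map opp w)"

lemma mset_darts_power_up:
  assumes "fold move w p = shift t p"
  shows "fold move (concat (replicate k w)) p = shift (t * int k) p"
    and "mset (darts p (concat (replicate k w))) =
      (\<Sum>j<k. image_mset (shift_dart (t * int j)) (mset (darts p w)))"
proof (induction k)
  case (Suc k)
  have rep: "concat (replicate (Suc k) w) = concat (replicate k w) @ w"
    by (metis concat.simps concat_append replicate_Suc replicate_append_same append_Nil2)
  { case 1
    show ?case using Suc.IH(1) assms by (simp only: rep fold_append) (simp add: fold_move_shift algebra_simps)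
  next
    case 2
    show ?case using Suc.IH by (simp only: rep darts_append) (simp add: darts_shift)
  }
qed simp_all

text \<open>The descent meets its copies from the top downwards, yet as a multiset it consists of
  the same translates \<open>t * j\<close> with \<open>j < k\<close> as an ascent. This allows the
  two sides of the snake to be merged period by period.\<close>

lemma mset_darts_power_down:
  assumes "fold move w (shift t q) = q"
  shows "fold move (concat (replicate k w)) (shift (t * int k) q) = q"
    and "mset (darts (shift (t * int k) q) (concat (replicate k w))) =
      (\<Sum>j<k. image_mset (shift_dart (t * int j)) (mset (darts (shift t q) w)))"
proof (induction k)
  case (Suc k)
  have s: "shift (t * int (Suc k)) q = shift (t * int k) (shift t q)"
    by (simp add: algebra_simps)
  have m: "fold move w (shift (t * int (Suc k)) q) = shift (t * int k) q"
    unfolding s by (subst fold_move_shift) (simp only: assms)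
  { case 1
    show ?case using Suc.IH(1) by (simp only: replicate_Suc concat.simps fold_append comp_apply m)
  next
    case 2
    have "darts (shift (t * int (Suc k)) q) w = map (shift_dart (t * int k)) (darts (shift t q) w)"
      unfolding s by (rule darts_shift)
    then show ?case
      using Suc.IH(2) by (simp only: replicate_Suc concat.simps darts_append m) simp
  }
qed simp_all

text \<open>Serves to bound the length of the circuit from below: a period that moves by
  \<open>(4, 4)\<close> has at least four letters.\<close>

lemma fst_fold_move: "\<bar>fst (fold move w u) - fst u\<bar> \<le> int (length w)"
proof (induction w arbitrary: u)
  case (Cons d w)
  have "\<bar>fst (move d u) - fst u\<bar> \<le> 1" by (cases d; cases u) simp_all
  then show ?case using Cons.IH[of "move d u"] by simp
qed simp

lemma image_mset_sum_lessThan: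
  "image_mset f (\<Sum>j<k. M j) = (\<Sum>j<k. image_mset f (M j))" for k :: nat
  by (induction k) simp_all

lemma Union_closed_walk_edges: "\<Union> (closed_walk_edges p) = set p"
proof
  have "Suc i mod length p < length p" if "i < length p" for i
    using that by (intro mod_less_divisor) linarith
  then show "\<Union> (closed_walk_edges p) \<subseteq> set p"
    by (auto simp: closed_walk_edges_def)
  show "set p \<subseteq> \<Union> (closed_walk_edges p)"
  proof
    fix u assume "u \<in> set p"
    then obtain i where "i < length p" "u = p ! i" by (auto simp: in_set_conv_nth)
    then show "u \<in> \<Union> (closed_walk_edges p)"
      unfolding closed_walk_edges_def by (intro UnionI[of "{p ! i, p ! (Suc i mod length p)}"]) auto
  qed
qed

text \<open>A complete invariant of a point under the translations by multiples of
  \<open>(4, 4)\<close>.\<close>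

definition orbit :: "point \<Rightarrow> int \<times> int" where
  "orbit u = (fst u - snd u, fst u mod 4)"

lemma orbit_shift: "orbit (shift (4 * j) u) = orbit u"
  by (simp add: orbit_def)

definition inner_first :: "dart list \<Rightarrow> dart list \<Rightarrow> point multiset" where
  "inner_first ds ds' = filter_mset (\<lambda>c. 1 \<le> fst c \<and> 1 \<le> snd c) (walk_cells (ds @ ds'))"

text \<open>With \<open>k + 2\<close> periods the grid has side \<open>4 * k + 12\<close>, so cell
  coordinates go up to \<open>4 * k + 11\<close>. The last period is moved by
  \<open>4 * k + 4\<close> in all, which leaves the bound 7 before the translation.\<close>

definition inner_last :: "dart list \<Rightarrow> dart list \<Rightarrow> point multiset" where
  "inner_last ds ds' = image_mset (shift 4)
     (filter_mset (\<lambda>c. fst c \<le> 7 \<and> snd c \<le> 7) (walk_cells ds + image_mset (shift 4) (walk_cells ds')))"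

lemma count_image_mset_shift: "count (image_mset (shift t) M) c = count M (shift (- t) c)"
proof -
  have "c = shift t u \<longleftrightarrow> shift (- t) c = u" for u
    by (cases c; cases u) auto
  then show ?thesis
    by (induction M) auto
qed

text \<open>The closed walk starts at \<open>(1, 1)\<close>, follows \<open>a\<close> and then \<open>k\<close> copies of \<open>b\<close> upwards, turns by \<open>e\<close>,
  and returns by \<open>k\<close> copies of \<open>b'\<close> and by \<open>a'\<close>.  Two vertices on different copies of the period
  can only coincide if they have the same orbit under the translation by \<open>(4, 4)\<close>.\<close>
locale periodic_cycle =
  fixes a b e b' a' :: "dir list" and p q :: point and first_part period last_part :: "dart list"
  assumes p: "p = fold move a (1, 1)" and q: "q = fold move e p"
    and up: "fold move b p = shift 4 p" and down: "fold move b' (shift 4 q) = q"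
    and close: "fold move a' q = (1, 1)"
    and first_part: "first_part = darts (1, 1) a @ darts q a'"
    and period: "period = darts p b @ darts (shift 4 q) b'"
    and last_part: "last_part = darts p e"
    and distinct_first: "distinct (map fst first_part)"
    and distinct_period: "distinct (map (orbit \<circ> fst) period)"
    and distinct_last: "distinct (map fst last_part)"
    and first_period: "\<forall>x\<in>set (map fst first_part). \<forall>y\<in>set (map fst period). orbit x = orbit y \<longrightarrow> fst x < fst y"
    and last_period: "\<forall>x\<in>set (map fst last_part). \<forall>y\<in>set (map fst period). orbit x = orbit y \<longrightarrow> fst y \<le> fst x"
    and first_last: "\<forall>x\<in>set (map fst first_part). \<forall>y\<in>set (map fst last_part). orbit x = orbit y \<longrightarrow> fst x \<le> fst y"
    and box_ends: "\<forall>u\<in>set (map fst (first_part @ last_part)). 1 \<le> fst u \<and> fst u \<le> 4 \<and> 1 \<le> snd u \<and> snd u \<le> 4"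
    and box_period: "\<forall>u\<in>set (map fst period). 1 \<le> fst u \<and> fst u \<le> 8 \<and> 1 \<le> snd u \<and> snd u \<le> 8"
begin

section \<open>The circuit with \<open>k\<close> periods is a cycle of the grid\<close>

definition word :: "nat \<Rightarrow> dir list" where
  "word k = a @ concat (replicate k b) @ e @ concat (replicate k b') @ a'"

definition circuit :: "nat \<Rightarrow> point set set" where
  "circuit k = closed_walk_edges (map fst (darts (1, 1) (word k)))"

lemma fold_word: "fold move (word k) (1, 1) = (1, 1)"
  using mset_darts_power_up(1)[OF up, of k] mset_darts_power_down(1)[OF down, of k]
  by (simp add: word_def close fold_move_shift flip: p q)

lemma mset_darts_word:
  "mset (darts (1, 1) (word k)) = mset first_part
    + (\<Sum>j<k. image_mset (shift_dart (4 * int j)) (mset period))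
    + image_mset (shift_dart (4 * int k)) (mset last_part)"
proof -
  have fp: "fold move (concat (replicate k b)) p = shift (4 * int k) p"
    by (rule mset_darts_power_up(1)[OF up])
  have fq: "fold move (concat (replicate k b')) (shift (4 * int k) q) = q"
    by (rule mset_darts_power_down(1)[OF down])
  have fe: "fold move e (shift (4 * int k) p) = shift (4 * int k) q"
    by (simp add: fold_move_shift q)
  have "mset (darts (1, 1) (word k)) = mset (darts (1, 1) a) + mset (darts p (concat (replicate k b)))
     + mset (darts (shift (4 * int k) p) e) + mset (darts (shift (4 * int k) q) (concat (replicate k b')))
     + mset (darts q a')"
    by (simp add: word_def darts_append fp fq fe flip: p)
  then show ?thesis
    unfolding mset_darts_power_up(2)[OF up] mset_darts_power_down(2)[OF down]
    by (simp add: first_part period last_part darts_shift sum.distrib)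
qed

lemma set_verts:
  "set (map fst (darts (1, 1) (word k))) = set (map fst first_part)
    \<union> (\<Union>j<k. shift (4 * int j) ` set (map fst period)) \<union> shift (4 * int k) ` set (map fst last_part)"
proof -
  have "set (darts (1, 1) (word k)) = set first_part
    \<union> (\<Union>j<k. shift_dart (4 * int j) ` set period) \<union> shift_dart (4 * int k) ` set last_part"
    using arg_cong[OF mset_darts_word[of k], of set_mset] by (simp add: set_mset_sum)
  then show ?thesis by (simp add: image_Un image_UN image_image)
qed

text \<open>Points of one orbit are ordered by their first coordinate. A head vertex lies strictly
  before the period vertices of its orbit, so no translate with \<open>j \<ge> 0\<close> reaches it.
  For the last part weak inequalities suffice: it is moved by \<open>4 * k\<close>, strictly further
  than any period and than the head.\<close>

lemma distinct_verts:
  assumes "0 < k"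
  shows "distinct (map fst (darts (1, 1) (word k)))"
proof -
  define block where "block j = map (shift (4 * int j) \<circ> fst) period" for j
  have per: "x = y" if "x \<in> set (map fst period)" "y \<in> set (map fst period)" "orbit x = orbit y" for x y
    using that distinct_period by (auto simp: distinct_map inj_on_def simp del: split_paired_All)
  have set_block: "set (block j) = shift (4 * int j) ` set (map fst period)" for j
    by (simp add: block_def image_comp)
  have set_last: "set (map (shift (4 * int k) \<circ> fst) last_part) = shift (4 * int k) ` set (map fst last_part)"
    by (simp add: image_comp)
  have "distinct (map fst period)"
    using distinct_period by (metis distinct_map map_map)
  then have d: "distinct (block j)" for j
    unfolding block_def map_map[symmetric] distinct_map[of "shift (4 * int j)"]
    using inj_shift by (metis inj_on_subset subset_UNIV)
  have disj: "set (block i) \<inter> set (block j) = {}" if "i < j" for i j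
  proof -
    have False if "x \<in> set (map fst period)" "y \<in> set (map fst period)"
      and eq: "shift (4 * int i) x = shift (4 * int j) y" for x y
    proof -
      have "orbit x = orbit y" using eq by (metis orbit_shift)
      then have "x = y" using per that by blast
      then show False using arg_cong[OF eq, of fst] \<open>i < j\<close> by simp
    qed
    then show ?thesis unfolding set_block set_last by blast
  qed
  have blocks: "distinct (concat (map block [0..<m]))" for m
  proof (induction m)
    case (Suc m)
    have "set (concat (map block [0..<m])) \<inter> set (block m) = {}"
      using disj by (fastforce simp del: split_paired_All)
    then show ?case using Suc.IH d by simp
  qed simp
  have fb: "set (map fst first_part) \<inter> set (block j) = {}" for j
  proof -
    have False if "x \<in> set (map fst first_part)" "y \<in> set (map fst period)"
      and eq: "x = shift (4 * int j) y" for x y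
    proof -
      have "fst x < fst y" using that first_period by (metis orbit_shift)
      then show False using arg_cong[OF eq, of fst] by simp
    qed
    then show ?thesis unfolding set_block set_last by blast
  qed
  have lb: "set (map (shift (4 * int k) \<circ> fst) last_part) \<inter> set (block j) = {}" if "j < k" for j
  proof -
    have False if "x \<in> set (map fst last_part)" "y \<in> set (map fst period)"
      and eq: "shift (4 * int k) x = shift (4 * int j) y" for x y
    proof -
      have "fst y \<le> fst x" using that last_period by (metis orbit_shift)
      then show False using arg_cong[OF eq, of fst] \<open>j < k\<close> by simp
    qed
    then show ?thesis unfolding set_block set_last by blast
  qed
  have fl: "set (map fst first_part) \<inter> set (map (shift (4 * int k) \<circ> fst) last_part) = {}"
  proof -
    have False if "x \<in> set (map fst first_part)" "y \<in> set (map fst last_part)"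
      and eq: "x = shift (4 * int k) y" for x y
    proof -
      have "fst x \<le> fst y" using that first_last by (metis orbit_shift)
      then show False using arg_cong[OF eq, of fst] \<open>0 < k\<close> by simp
    qed
    then show ?thesis unfolding set_last by blast
  qed
  have dl: "distinct (map (shift (4 * int k) \<circ> fst) last_part)"
    unfolding map_map[symmetric] distinct_map[of "shift (4 * int k)"]
    using distinct_last inj_shift by (metis inj_on_subset subset_UNIV)
  let ?vs = "map fst first_part @ concat (map block [0..<k]) @ map (shift (4 * int k) \<circ> fst) last_part"
  have "mset (map fst (darts (1, 1) (word k))) = mset ?vs"
  proof -
    have "mset (concat (map block [0..<m])) = (\<Sum>j<m. image_mset (shift (4 * int j) \<circ> fst) (mset period))" for m
      by (induction m) (simp_all add: block_def comp_def)
    then show ?thesis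
      by (simp add: mset_darts_word image_mset_sum_lessThan multiset.map_comp comp_def)
  qed
  moreover have "distinct ?vs"
  proof -
    define F where "F = map fst first_part"
    define W where "W = map (shift (4 * int k) \<circ> fst) last_part"
    have eq: "set (concat (map block [0..<k])) = (\<Union>j<k. set (block j))" by auto
    have "set W \<inter> set (concat (map block [0..<k])) = {}"
      unfolding eq Int_UN_distrib using lb[folded W_def] by simp
    moreover have "set F \<inter> set (concat (map block [0..<k])) = {}"
      unfolding eq Int_UN_distrib using fb[folded F_def] by simp
    ultimately have "distinct (F @ concat (map block [0..<k]) @ W)"
      using distinct_first[folded F_def] blocks[of k] dl[folded W_def] fl[folded F_def W_def]
      by (simp only: distinct_append set_append Int_Un_distrib Int_commute[of "set W"] simp_thms Un_empty)
    then show ?thesis unfolding F_def W_def .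
  qed
  ultimately show ?thesis by (rule iffD2[OF mset_eq_imp_distinct_iff])
qed

lemma length_word:
  assumes "0 < k"
  shows "3 \<le> length (word k)"
proof -
  have "3 \<le> length b"
    using fst_fold_move[of b p] up by simp
  moreover have "length b \<le> length (concat (replicate k b))"
    using assms by (cases k) auto
  ultimately show ?thesis by (simp add: word_def)
qed

lemma circuit_eq: "circuit k = edge_of ` set (darts (1, 1) (word k))"
  unfolding circuit_def by (rule closed_walk_edges_darts[OF fold_word])

lemma Union_circuit: "\<Union> (circuit k) = set (map fst (darts (1, 1) (word k)))"
  unfolding circuit_def Union_closed_walk_edges ..

lemma grid_cycle_circuit:
  assumes "0 < k"
  shows "grid_cycle (4 * k + 4) (circuit k)"
proof -
  have box: "u \<in> grid_vertices (4 * k + 4)" if "u \<in> \<Union> (circuit k)" for u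
  proof -
    from that have "u \<in> set (map fst first_part) \<or> u \<in> (\<Union>j<k. shift (4 * int j) ` set (map fst period))
        \<or> u \<in> shift (4 * int k) ` set (map fst last_part)"
      by (simp only: Union_circuit set_verts Un_iff disj_assoc)
    then consider "u \<in> set (map fst first_part)"
      | "u \<in> (\<Union>j<k. shift (4 * int j) ` set (map fst period))"
      | "u \<in> shift (4 * int k) ` set (map fst last_part)"
      by argo
    then have "1 \<le> fst u \<and> fst u \<le> 4 * int k + 4 \<and> 1 \<le> snd u \<and> snd u \<le> 4 * int k + 4"
    proof cases
      case 1
      then have "1 \<le> fst u \<and> fst u \<le> 4 \<and> 1 \<le> snd u \<and> snd u \<le> 4"
        using box_ends by (metis Un_iff map_append set_append)
      then show ?thesis by linarith
    next
      case 2
      then obtain j v where jv: "j < k" "v \<in> set (map fst period)" "u = shift (4 * int j) v"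
        by (elim UN_E imageE) (simp only: lessThan_iff)
      then have "1 \<le> fst v \<and> fst v \<le> 8 \<and> 1 \<le> snd v \<and> snd v \<le> 8"
        using box_period by blast
      \<comment> \<open>The extreme case is \<open>j = k - 1\<close>, where
        \<open>8 + 4 * (k - 1)\<close> is exactly the side \<open>4 * k + 4\<close>.\<close>
      with jv(1,3) show ?thesis by (simp only: fst_shift snd_shift) linarith
    next
      case 3
      then obtain v where v: "v \<in> set (map fst last_part)" "u = shift (4 * int k) v"
        by (elim imageE)
      then have "1 \<le> fst v \<and> fst v \<le> 4 \<and> 1 \<le> snd v \<and> snd v \<le> 4"
        using box_ends by (metis Un_iff map_append set_append)
      with v(2) show ?thesis by (simp only: fst_shift snd_shift) linarith
    qed
    then show ?thesis by (cases u) (simp add: grid_vertices_def)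
  qed
  have "e \<in> grid_edges (4 * k + 4)" if e: "e \<in> circuit k" for e
  proof -
    obtain u v where uv: "e = {u, v}" "(u, v) \<in> set (darts (1, 1) (word k))"
      using e unfolding circuit_eq by (metis edge_of.simps imageE surj_pair)
    then obtain d where "v = move d u" using in_darts_step by blast
    then have "\<bar>fst u - fst v\<bar> + \<bar>snd u - snd v\<bar> = 1"
      by (cases d; cases u) simp_all
    moreover have "u \<in> grid_vertices (4 * k + 4)" "v \<in> grid_vertices (4 * k + 4)"
      using box e uv(1) by blast+
    ultimately show ?thesis unfolding grid_edges_def uv(1) by blast
  qed
  then show ?thesis
    unfolding grid_cycle_def using distinct_verts[OF assms] length_word[OF assms]
    by (intro conjI subsetI exI[of _ "map fst (darts (1, 1) (word k))"]) (auto simp: circuit_def)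
qed

section \<open>The signature of the periodic circuit\<close>

lemma signature_circuit:
  assumes "0 < k" "c \<in> grid_cells n"
  shows "signature n (circuit k) c = count (walk_cells (darts (1, 1) (word k))) c"
  unfolding circuit_def
  by (rule signature_eq_count[OF fold_word distinct_verts[OF assms(1)] length_word[OF assms(1)] assms(2)])

lemma walk_cells_word:
  "walk_cells (darts (1, 1) (word k)) = walk_cells first_part
    + (\<Sum>j<k. image_mset (shift (4 * int j)) (walk_cells period))
    + image_mset (shift (4 * int k)) (walk_cells last_part)"
proof -
  let ?block = "\<lambda>j. map (shift_dart (4 * int j)) period"
  have "mset (concat (map ?block [0..<m])) = (\<Sum>j<m. image_mset (shift_dart (4 * int j)) (mset period))" for m
    by (induction m) simp_all
  then have "walk_cells (darts (1, 1) (word k)) =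
      walk_cells (first_part @ concat (map ?block [0..<k]) @ map (shift_dart (4 * int k)) last_part)"
    by (intro walk_cells_cong) (simp add: mset_darts_word)
  moreover have "walk_cells (concat (map ?block [0..<m])) = (\<Sum>j<m. image_mset (shift (4 * int j)) (walk_cells period))" for m
    by (induction m) (simp_all add: walk_cells_shift)
  ultimately show ?thesis
    by (simp add: walk_cells_shift)
qed

text \<open>A piece moved by 8 or more touches only cells of height at least 8, so below that height
  just the first two periods count. The bound in \<open>nonneg\<close> is 0 rather than 1 because a
  dart on the bottom side also lists the cell beneath it.\<close>

lemma signature_circuit_low:
  assumes nonneg: "\<forall>c \<in># walk_cells (period @ last_part). 0 \<le> snd c"
    and "2 \<le> k" "c \<in> grid_cells n" "snd c < 8"
  shows "signature n (circuit k) c = count (walk_cells (first_part @ period @ map (shift_dart 4) period)) c"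
proof -
  have zero: "count (image_mset (shift (4 * int j)) (walk_cells ds)) c = 0"
    if "2 \<le> j" "\<forall>c \<in># walk_cells ds. 0 \<le> snd c" for j ds
  proof -
    have "c \<notin># image_mset (shift (4 * int j)) (walk_cells ds)"
      using that assms(4) by fastforce
    then show ?thesis by (simp only: not_in_iff)
  qed
  have "(\<Sum>j<k. count (image_mset (shift (4 * int j)) (walk_cells period)) c)
      = (\<Sum>j<2. count (image_mset (shift (4 * int j)) (walk_cells period)) c)"
    using assms(1,2) zero by (intro sum.mono_neutral_right) auto
  also have "\<dots> = count (walk_cells period) c + count (image_mset (shift 4) (walk_cells period)) c"
    by (simp add: numeral_2_eq_2)
  finally show ?thesis
    using assms zero[of k last_part]
    by (simp add: signature_circuit walk_cells_word count_sum walk_cells_shift)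
qed

text \<open>Cells outside the grid carry no clue.  Only the first and the last period touch the border of
  the grid, so these two are split off and filtered.\<close>
lemma signature_circuit_inner:
  assumes c: "c \<in> grid_cells (4 * (k + 2) + 4)"
  shows "signature (4 * (k + 2) + 4) (circuit (k + 2)) c = count
    (inner_first first_part period
      + (\<Sum>j<k. image_mset (shift (4 * int j)) (image_mset (shift 4) (walk_cells period)))
      + image_mset (shift (4 * int k)) (inner_last period last_part)) c"
proof -
  define X where "X = walk_cells period + image_mset (shift 4) (walk_cells last_part)"
  have bounds: "1 \<le> fst c" "1 \<le> snd c" "fst c \<le> 4 * int k + 11" "snd c \<le> 4 * int k + 11"
    using c by (auto simp: grid_cells_def)
  have "walk_cells (darts (1, 1) (word (k + 2))) = walk_cells first_part + walk_cells period
      + (\<Sum>j<k. image_mset (shift (4 * int j)) (image_mset (shift 4) (walk_cells period)))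
      + image_mset (shift (4 * int k)) (image_mset (shift 4) X)"
  proof -
    have split: "(\<Sum>j<k + 2. f j) = f 0 + (\<Sum>j<k. f (Suc j)) + f (Suc k)" for f :: "nat \<Rightarrow> point multiset"
      by (simp only: add_2_eq_Suc' sum.lessThan_Suc[of _ "Suc k"] sum.lessThan_Suc_shift[of _ k])
    show ?thesis
      unfolding walk_cells_word X_def split
      by (simp add: image_mset.compositionality comp_def algebra_simps)
  qed
  moreover have "count (walk_cells first_part + walk_cells period) c = count (inner_first first_part period) c"
    using bounds by (simp add: inner_first_def)
  moreover have "count (image_mset (shift (4 * int k)) (image_mset (shift 4) X)) c
      = count (image_mset (shift (4 * int k)) (inner_last period last_part)) c"
    using bounds by (simp add: inner_last_def X_def count_image_mset_shift)
  ultimately show ?thesis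
    using c by (simp add: signature_circuit)
qed

text \<open>Vertices of translated pieces have height at least 5. Membership of a low vertex is thus
  a question about finite data, which later tells the three circuits apart.\<close>

lemma low_verts:
  assumes "0 < k" "snd u \<le> 4"
  shows "u \<in> \<Union> (circuit k) \<longleftrightarrow> u \<in> set (map fst (first_part @ period))"
proof -
  have "u \<noteq> shift (4 * int j) v" if "0 < j" "v \<in> set (map fst (period @ last_part))" for j v
  proof -
    have "1 \<le> snd v" using that box_ends box_period by auto
    then show ?thesis using assms(2) that(1) by auto
  qed
  then have high: "u \<notin> shift (4 * int j) ` set (map fst (period @ last_part))" if "0 < j" for j
    using that by blast
  then have "u \<notin> shift (4 * int k) ` set (map fst last_part)"
    and "u \<in> shift (4 * int j) ` set (map fst period) \<longleftrightarrow> j = 0 \<and> u \<in> set (map fst period)" for j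
    using assms(1) high[of k] high[of j] by (cases "j = 0"; simp add: image_Un)+
  then show ?thesis
    unfolding Union_circuit set_verts using assms(1) by auto
qed

end

text \<open>Both sides satisfy the same recursion in \<open>k\<close>: going from \<open>k\<close> to \<open>k + 1\<close> adds a
  period and moves the last part, so two multiset identities suffice for all \<open>k\<close>.\<close>
lemma unrolled_eq:
  fixes A B E A' B' E' :: "point multiset"
  assumes ends: "A + E = A' + E'"
    and period: "B + image_mset (shift 4) E + E' = B' + image_mset (shift 4) E' + E"
  shows "A + (\<Sum>j<k. image_mset (shift (4 * int j)) B) + image_mset (shift (4 * int k)) E
       = A' + (\<Sum>j<k. image_mset (shift (4 * int j)) B') + image_mset (shift (4 * int k)) E'"
proof (induction k)
  case 0
  then show ?case using ends by simp
next
  case (Suc k)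
  have "image_mset (shift (4 * int k)) (B + image_mset (shift 4) E + E')
      = image_mset (shift (4 * int k)) (B' + image_mset (shift 4) E' + E)"
    using period by (rule arg_cong)
  then have "image_mset (shift (4 * int k)) B + image_mset (shift (4 * int (Suc k))) E + image_mset (shift (4 * int k)) E'
      = image_mset (shift (4 * int k)) B' + image_mset (shift (4 * int (Suc k))) E' + image_mset (shift (4 * int k)) E"
    by (simp add: image_mset.compositionality comp_def add.commute)
  \<comment> \<open>The translates of \<open>E\<close> and \<open>E'\<close> by \<open>4 * k\<close>
    now occur on both sides and cancel. This is why the period identity carries \<open>E'\<close> on
    its left and \<open>E\<close> on its right.\<close>
  with Suc.IH have "A + (\<Sum>j<k. image_mset (shift (4 * int j)) B) + image_mset (shift (4 * int k)) E
     + (image_mset (shift (4 * int k)) B + image_mset (shift (4 * int (Suc k))) E + image_mset (shift (4 * int k)) E')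
    = A' + (\<Sum>j<k. image_mset (shift (4 * int j)) B') + image_mset (shift (4 * int k)) E'
     + (image_mset (shift (4 * int k)) B' + image_mset (shift (4 * int (Suc k))) E' + image_mset (shift (4 * int k)) E)"
    by simp
  then show ?case by (simp add: ac_simps)
qed

section \<open>The three snakes\<close>

datatype variant = First | Second | Third

text \<open>The left and the right boundary of each snake, read from \<open>(1, 1)\<close> to \<open>(n, n)\<close>, consist of a head,
  \<open>k\<close> periods and a tail.  The words were found by a computer search.\<close>
fun left_head :: "variant \<Rightarrow> dir list" where
  "left_head First = [U, R]"
| "left_head Second = [U, U]"
| "left_head Third = [U, R, U]"

fun left_period :: "variant \<Rightarrow> dir list" where
  "left_period First = [U, U, U, L, U, U, U, R, R, R, R, D, D, D, D, D, D, R, R, U, L, U, U, U]"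
| "left_period Second = [R, R, R, R, D, R, R, U, L, U, L, L, L, L, U, L, U, U, U, R, R, R, R, D]"
| "left_period Third = [R, R, R, R, D, R, U, U, L, L, L, L, L, L, U, U, U, U, R, R, R, D, R, R]"

fun left_tail :: "variant \<Rightarrow> dir list" where
  "left_tail First = [U, U, R, R]"
| "left_tail Second = [R, R, U, R]"
| "left_tail Third = [U, R, R]"

fun right_head :: "variant \<Rightarrow> dir list" where
  "right_head First = [R, R]"
| "right_head Second = [R, U]"
| "right_head Third = [R, R, U]"

fun right_period :: "variant \<Rightarrow> dir list" where
  "right_period First = [U, U, U, U, U, L, U, R, R, D, D, D, D, D, D, R, R, R, R, U, U, U, L, U]"
| "right_period Second = [R, R, D, R, R, R, R, U, U, U, L, U, L, L, L, L, U, L, U, R, R, D, R, R]"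
| "right_period Third = [R, R, D, R, R, R, U, U, U, U, L, L, L, L, L, L, U, U, R, D, R, R, R, R]"

fun right_tail :: "variant \<Rightarrow> dir list" where
  "right_tail First = [U, U, R, U]"
| "right_tail Second = [R, R, U, U]"
| "right_tail Third = [U, R, U]"

text \<open>The two tails meet at \<open>(4, 4)\<close>, which \<open>k\<close> translations carry
  to the corner \<open>(n, n)\<close>; there the boundary turns from the left side of the snake to
  the right side.\<close>

definition cap :: "variant \<Rightarrow> dir list" where
  "cap i = left_tail i @ reverse_word (right_tail i)"

definition left_base :: "variant \<Rightarrow> point" where
  "left_base i = fold move (left_head i) (1, 1)"

definition right_base :: "variant \<Rightarrow> point" where
  "right_base i = fold move (cap i) (left_base i)"

definition head_darts :: "variant \<Rightarrow> dart list" where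
  "head_darts i = darts (1, 1) (left_head i) @ darts (right_base i) (reverse_word (right_head i))"

definition period_darts :: "variant \<Rightarrow> dart list" where
  "period_darts i = darts (left_base i) (left_period i)
     @ darts (shift 4 (right_base i)) (reverse_word (right_period i))"

definition cap_darts :: "variant \<Rightarrow> dart list" where
  "cap_darts i = darts (left_base i) (cap i)"

text \<open>Each assumption speaks of fixed finite lists and not of \<open>k\<close>, so evaluation
  decides it for every variant. Keeping \<open>i\<close> free makes \<open>snake.circuit\<close> a
  function of the variant.\<close>

interpretation snake: periodic_cycle "left_head i" "left_period i" "cap i"
  "reverse_word (right_period i)" "reverse_word (right_head i)" "left_base i" "right_base i"
  "head_darts i" "period_darts i" "cap_darts i" for i
proof unfold_locales
  show "left_base i = fold move (left_head i) (1, 1)" by (rule left_base_def)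
  show "right_base i = fold move (cap i) (left_base i)" by (rule right_base_def)
  show "fold move (left_period i) (left_base i) = shift 4 (left_base i)" by (induct i; code_simp)
  show "fold move (reverse_word (right_period i)) (shift 4 (right_base i)) = right_base i" by (induct i; code_simp)
  show "fold move (reverse_word (right_head i)) (right_base i) = (1, 1)" by (induct i; code_simp)
  show "head_darts i = darts (1, 1) (left_head i) @ darts (right_base i) (reverse_word (right_head i))"
    by (rule head_darts_def)
  show "period_darts i = darts (left_base i) (left_period i)
     @ darts (shift 4 (right_base i)) (reverse_word (right_period i))"
    by (rule period_darts_def)
  show "cap_darts i = darts (left_base i) (cap i)" by (rule cap_darts_def)
  show "distinct (map fst (head_darts i))" by (induct i; code_simp)
  show "distinct (map (orbit \<circ> fst) (period_darts i))" by (induct i; code_simp)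
  show "distinct (map fst (cap_darts i))" by (induct i; code_simp)
  show "\<forall>x\<in>set (map fst (head_darts i)). \<forall>y\<in>set (map fst (period_darts i)). orbit x = orbit y \<longrightarrow> fst x < fst y"
    by (induct i; code_simp)
  show "\<forall>x\<in>set (map fst (cap_darts i)). \<forall>y\<in>set (map fst (period_darts i)). orbit x = orbit y \<longrightarrow> fst y \<le> fst x"
    by (induct i; code_simp)
  show "\<forall>x\<in>set (map fst (head_darts i)). \<forall>y\<in>set (map fst (cap_darts i)). orbit x = orbit y \<longrightarrow> fst x \<le> fst y"
    by (induct i; code_simp)
  show "\<forall>u\<in>set (map fst (head_darts i @ cap_darts i)). 1 \<le> fst u \<and> fst u \<le> 4 \<and> 1 \<le> snd u \<and> snd u \<le> 4"
    by (induct i; code_simp)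
  show "\<forall>u\<in>set (map fst (period_darts i)). 1 \<le> fst u \<and> fst u \<le> 8 \<and> 1 \<le> snd u \<and> snd u \<le> 8"
    by (induct i; code_simp)
qed

text \<open>Sorting makes the evaluation of multiset equations much faster than successive cancellation.\<close>
lemma multiset_eqI_sorted:
  "sorted_list_of_multiset M = sorted_list_of_multiset N \<Longrightarrow> M = N"
  by (metis mset_sorted_list_of_multiset)

text \<open>The base case of the unrolling: a comparison of the snakes with two periods, in the grid
  of side 12.\<close>

lemma inner_cells_ends:
  "inner_first (head_darts i) (period_darts i) + inner_last (period_darts i) (cap_darts i)
     = inner_first (head_darts First) (period_darts First) + inner_last (period_darts First) (cap_darts First)"
  by (induct i) (rule refl, (rule multiset_eqI_sorted, code_simp)+)

text \<open>The exchange identity for one more period. The repeated block is translated by 4 because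
  the initial period already belongs to \<open>inner_first\<close>.\<close>

lemma inner_cells_period:
  "image_mset (shift 4) (walk_cells (period_darts i)) + image_mset (shift 4) (inner_last (period_darts i) (cap_darts i))
       + inner_last (period_darts First) (cap_darts First)
     = image_mset (shift 4) (walk_cells (period_darts First))
       + image_mset (shift 4) (inner_last (period_darts First) (cap_darts First))
       + inner_last (period_darts i) (cap_darts i)"
  by (induct i) (rule refl, (rule multiset_eqI_sorted, code_simp)+)

lemma signature_snake:
  "signature (4 * (k + 2) + 4) (snake.circuit i (k + 2)) = signature (4 * (k + 2) + 4) (snake.circuit First (k + 2))"
proof
  fix c
  show "signature (4 * (k + 2) + 4) (snake.circuit i (k + 2)) c
      = signature (4 * (k + 2) + 4) (snake.circuit First (k + 2)) c"
  proof (cases "c \<in> grid_cells (4 * (k + 2) + 4)")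
    case True
    then show ?thesis
      unfolding snake.signature_circuit_inner[OF True]
      by (simp only: unrolled_eq[OF inner_cells_ends inner_cells_period, of i k])
  next
    case False
    \<comment> \<open>Outside the cells both restricted functions take the value
      \<open>undefined\<close>.\<close>
    then show ?thesis by (simp only: signature_def restrict_apply if_False)
  qed
qed

lemma inj_snake:
  assumes "0 < k"
  shows "inj (\<lambda>i. snake.circuit i k)"
proof (rule injI)
  fix i j assume eq: "snake.circuit i k = snake.circuit j k"
  \<comment> \<open>Two vertices of the bottom side suffice to separate three boundaries: one
    variant avoids the one, another variant avoids the other, and \<open>First\<close> passes
    through both.\<close>
  have verts: "(3, 1) \<in> set (map fst (head_darts i @ period_darts i)) \<longleftrightarrow> i \<noteq> Second"
    "(4, 1) \<in> set (map fst (head_darts i @ period_darts i)) \<longleftrightarrow> i \<noteq> Third" for i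
    by (induct i; code_simp)+
  have low: "(3, 1) \<in> \<Union> (snake.circuit i k) \<longleftrightarrow> i \<noteq> Second" "(4, 1) \<in> \<Union> (snake.circuit i k) \<longleftrightarrow> i \<noteq> Third" for i
    by (simp_all only: snake.low_verts[OF assms] verts snd_conv one_le_numeral)
  have "i = Second \<longleftrightarrow> j = Second" "i = Third \<longleftrightarrow> j = Third"
    using low[of i, unfolded eq] low[of j] by argo+
  then show "i = j" by (metis variant.exhaust)
qed

lemma UNIV_variant: "UNIV = {First, Second, Third}"
  using variant.exhaust by blast

section \<open>The clues of the lower left corner\<close>

definition low_cells :: "point multiset" where
  "low_cells = walk_cells (head_darts First @ period_darts First @ map (shift_dart 4) (period_darts First))"

lemma signature_snake_low:
  assumes "2 \<le> k" "c \<in> grid_cells n" "snd c < 8"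
  shows "signature n (snake.circuit First k) c = count low_cells c"
proof -
  have "\<forall>c\<in>#walk_cells (period_darts First @ cap_darts First). 0 \<le> snd c" by code_simp
  then show ?thesis unfolding low_cells_def by (rule snake.signature_circuit_low[OF _ assms])
qed

lemma low_cells_clues:
  "\<forall>c\<in>set [(1, 2), (1, 4), (2, 1), (2, 2), (2, 4), (3, 1), (3, 3), (4, 1), (4, 2), (5, 1), (5, 2), (7, 1)].
     count low_cells c = 2"
  "count low_cells (1, 3) = 1"
  "count low_cells (6, 2) = 3"
  by code_simp+

text \<open>The boundary leaves the bottom side upwards at \<open>(8, 1)\<close>. That vertical edge
  still touches the cell \<open>(8, 1)\<close>, so the clues vanish only from the ninth cell on and
  eight bottom edges have to be examined.\<close>

lemma low_cells_bottom: "\<forall>c\<in>#low_cells. snd c = 1 \<longrightarrow> fst c \<le> 8"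
  by code_simp

text \<open>The next four equivalences turn degree and clue constraints into clauses for the SAT solver.\<close>
lemma degree_iff:
  "of_bool a + of_bool b + of_bool c + of_bool d \<in> {0::nat, 2} \<longleftrightarrow>
     (a \<longrightarrow> b \<or> c \<or> d) \<and> (b \<longrightarrow> a \<or> c \<or> d) \<and> (c \<longrightarrow> a \<or> b \<or> d) \<and> (d \<longrightarrow> a \<or> b \<or> c) \<and>
     \<not> (a \<and> b \<and> c) \<and> \<not> (a \<and> b \<and> d) \<and> \<not> (a \<and> c \<and> d) \<and> \<not> (b \<and> c \<and> d)"
  by (cases a; cases b; cases c; cases d) simp_all

lemma clue_1_iff:
  "of_bool a + of_bool b + of_bool c + of_bool d = (1::nat) \<longleftrightarrow>
     (a \<or> b \<or> c \<or> d) \<and> \<not> (a \<and> b) \<and> \<not> (a \<and> c) \<and> \<not> (a \<and> d) \<and> \<not> (b \<and> c) \<and> \<not> (b \<and> d) \<and> \<not> (c \<and> d)"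
  by (cases a; cases b; cases c; cases d) simp_all

lemma clue_2_iff:
  "of_bool a + of_bool b + of_bool c + of_bool d = (2::nat) \<longleftrightarrow>
     (a \<or> b \<or> c) \<and> (a \<or> b \<or> d) \<and> (a \<or> c \<or> d) \<and> (b \<or> c \<or> d) \<and>
     \<not> (a \<and> b \<and> c) \<and> \<not> (a \<and> b \<and> d) \<and> \<not> (a \<and> c \<and> d) \<and> \<not> (b \<and> c \<and> d)"
  by (cases a; cases b; cases c; cases d) simp_all

lemma clue_3_iff:
  "of_bool a + of_bool b + of_bool c + of_bool d = (3::nat) \<longleftrightarrow>
     \<not> (a \<and> b \<and> c \<and> d) \<and> (a \<or> b) \<and> (a \<or> c) \<and> (a \<or> d) \<and> (b \<or> c) \<and> (b \<or> d) \<and> (c \<or> d)"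
  by (cases a; cases b; cases c; cases d) simp_all

text \<open>The constraints fix the bottom edges 1, 3, 5, 6, 7 and 8, and of edges 2 and 4 at least
  one must be present. This leaves three rows, which are those of the three snakes.\<close>

lemma corner_forces_bottom_row:
  assumes C: "C \<subseteq> grid_edges n"
    and degree: "\<And>x y. vertex_sum C x y \<in> {0, 2}"
    and clue_2: "\<forall>(x, y)\<in>set [(1, 2), (1, 4), (2, 1), (2, 2), (2, 4), (3, 1), (3, 3), (4, 1), (4, 2), (5, 1), (5, 2), (7, 1)].
       cell_sum C x y = 2"
    and clue_1: "cell_sum C 1 3 = 1" and clue_3: "cell_sum C 6 2 = 3"
  shows "map (\<lambda>x. hor C x 1) [1..8] \<in>
    {[True, True, False, True, True, True, True, False],
     [True, False, False, True, True, True, True, False],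
     [True, True, False, False, True, True, True, False]}"
proof -
  \<comment> \<open>These are the edges beyond the left and bottom sides that occur in the degree
    sums of border vertices.\<close>
  have border: "\<not> hor C 0 y" "\<not> ver C x 0" for x y
    using hor_in_grid(1)[OF C, of 0 y] ver_in_grid(3)[OF C, of x 0] by auto
  note degrees =
    degree[of 1 1]
    degree[of 1 2]
    degree[of 1 3]
    degree[of 1 4]
    degree[of 2 1]
    degree[of 2 2]
    degree[of 2 3]
    degree[of 2 5]
    degree[of 3 1]
    degree[of 3 2]
    degree[of 3 4]
    degree[of 4 1]
    degree[of 4 3]
    degree[of 5 1]
    degree[of 5 2]
    degree[of 6 1]
    degree[of 6 3]
    degree[of 7 2]
    degree[of 8 1]
  have "(hor C 1 1 \<and> \<not> hor C 3 1 \<and> hor C 5 1 \<and> hor C 6 1 \<and> hor C 7 1 \<and> \<not> hor C 8 1)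
      \<and> (hor C 2 1 \<or> hor C 4 1)"
    using border[of 1] border[of 2] border[of 3] border[of 4] border[of 5] border[of 6] border[of 7] border[of 8]
      degrees clue_2 clue_1 clue_3
    unfolding vertex_sum_def cell_sum_def degree_iff list.set ball_simps prod.case
      clue_1_iff clue_2_iff clue_3_iff
    by simp sat
  moreover have "[1..8] = [1, 2, 3, 4, 5, 6, 7, 8::int]" by code_simp
  ultimately show ?thesis by auto
qed

text \<open>The bottom row is an injective invariant on the cycles with this signature, by the
  upward sweep, and the corner allows it only three values. With \<open>k + 2\<close> periods at
  least two are present, as the computation of the low clues demands.\<close>

lemma card_cycles_same_signature:
  fixes k :: nat
  defines "n \<equiv> 4 * (k + 2) + 4" and "C \<equiv> snake.circuit First (k + 2)"
  defines "S \<equiv> {C'. grid_cycle n C' \<and> signature n C' = signature n C}"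
  shows "finite S" "card S \<le> 3"
proof -
  define row where "row C' = map (\<lambda>x. hor C' x 1) [1..8]" for C'
  have clue: "cell_sum C' x y = count low_cells (x, y)"
    if "C' \<in> S" "(x, y) \<in> grid_cells n" "y < 8" for C' x y
  proof -
    have "cell_sum C' x y = signature n C' (x, y)"
      using that(2) by (rule signature_eq_cell_sum[symmetric])
    also have "\<dots> = signature n C (x, y)" using that(1) by (simp add: S_def)
    also have "\<dots> = count low_cells (x, y)"
      unfolding n_def C_def using that(2,3) by (intro signature_snake_low) (simp_all add: n_def)
    finally show ?thesis .
  qed
  have sub: "C' \<subseteq> grid_edges n" and degree: "vertex_sum C' x y \<in> {0, 2}" if "C' \<in> S" for C' x y
    using that grid_cycle_vertex_sum[of n C'] by (auto simp: S_def grid_cycle_def)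
  have rows: "row ` S \<subseteq> {[True, True, False, True, True, True, True, False],
     [True, False, False, True, True, True, True, False],
     [True, True, False, False, True, True, True, False]}" (is "_ \<subseteq> ?rows")
  proof (rule image_subsetI)
    fix C' assume C': "C' \<in> S"
    have cell: "cell_sum C' x y = count low_cells (x, y)" if "1 \<le> x" "x < 8" "1 \<le> y" "y < 8" for x y
      using that by (intro clue[OF C']) (simp_all add: grid_cells_def n_def)
    show "row C' \<in> ?rows"
      unfolding row_def
    proof (rule corner_forces_bottom_row[OF sub[OF C'] degree[OF C']])
      show "\<forall>(x, y)\<in>set [(1, 2), (1, 4), (2, 1), (2, 2), (2, 4), (3, 1), (3, 3), (4, 1), (4, 2), (5, 1), (5, 2), (7, 1)].
          cell_sum C' x y = 2"
        using low_cells_clues(1) by (simp add: cell)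
      show "cell_sum C' 1 3 = 1" "cell_sum C' 6 2 = 3"
        using low_cells_clues(2,3) by (simp_all add: cell)
    qed
  qed
  have "inj_on row S"
  proof (rule inj_onI)
    fix C' C'' assume S: "C' \<in> S" "C'' \<in> S" and eq: "row C' = row C''"
    \<comment> \<open>A cell with clue 0 has no edge in the cycle, in particular not its bottom
      edge.\<close>
    have far: "\<not> hor D x 1" if "D \<in> S" "9 \<le> x" for D x
    proof
      assume h: "hor D x 1"
      have "(x, 1) \<in> grid_cells n"
        using hor_in_grid[OF sub[OF that(1)] h] by (simp add: grid_cells_def n_def)
      moreover have "(x, 1) \<notin># low_cells"
        using low_cells_bottom that(2) by fastforce
      ultimately have "cell_sum D x 1 = 0"
        using clue[OF that(1)] by (simp add: not_in_iff)
      then show False using h by (simp add: cell_sum_def)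
    qed
    have "hor C' x 1 = hor C'' x 1" for x
    proof (cases "1 \<le> x \<and> x \<le> 8")
      case True
      then have "x \<in> set [1..8]" by simp
      then show ?thesis using eq by (simp only: row_def map_eq_conv)
    next
      case False
      then consider "x < 1" | "9 \<le> x" by linarith
      then show ?thesis
        using hor_in_grid(1)[OF sub[OF S(1)], of x 1] hor_in_grid(1)[OF sub[OF S(2)], of x 1]
          far[OF S(1)] far[OF S(2)] by cases auto
    qed
    moreover have "cell_sum C' x y = cell_sum C'' x y" if "(x, y) \<in> grid_cells n" for x y
      using S by (simp add: S_def flip: signature_eq_cell_sum[OF that])
    moreover have "even (vertex_sum D x y)" if "D \<in> S" for D x y
      using degree[OF that, of x y] by auto
    ultimately show "C' = C''"
      using S by (intro edge_set_determined_by_bottom_row[OF sub sub])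
  qed
  moreover have "finite (row ` S)"
    using rows by (rule finite_subset) simp
  ultimately show "finite S" using finite_imageD by blast
  have "card S = card (row ` S)" using \<open>inj_on row S\<close> by (rule card_image[symmetric])
  also have "\<dots> \<le> card ?rows" using rows by (intro card_mono) simp_all
  also have "\<dots> = 3" by simp
  finally show "card S \<le> 3" .
qed

theorem proposition3:
  fixes n\<^sub>0 :: nat
  assumes "n\<^sub>0 > 0"
  shows "\<exists>n C. n \<ge> n\<^sub>0 \<and> grid_cycle n C \<and> sig_multiplicity n (signature n C) = 3"
proof (intro exI conjI)
  define k where "k = n\<^sub>0"
  let ?n = "4 * (k + 2) + 4"
  let ?C = "snake.circuit First (k + 2)"
  let ?S = "{C'. grid_cycle ?n C' \<and> signature ?n C' = signature ?n ?C}"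
  let ?Cs = "range (\<lambda>i. snake.circuit i (k + 2))"
  show "n\<^sub>0 \<le> ?n" by (simp add: k_def)
  show "grid_cycle ?n ?C" by (intro snake.grid_cycle_circuit) simp
  \<comment> \<open>Lower bound: the three circuits share the signature and are different by
    \<open>inj_snake\<close>. The bottom rows give the matching upper bound.\<close>
  have "?Cs \<subseteq> ?S"
    by (intro image_subsetI CollectI conjI snake.grid_cycle_circuit signature_snake) simp
  then have "card ?Cs \<le> card ?S"
    by (intro card_mono card_cycles_same_signature(1))
  moreover have "card ?Cs = 3"
    using card_image[OF inj_snake[of "k + 2"]] by (simp add: UNIV_variant)
  ultimately show "sig_multiplicity ?n (signature ?n ?C) = 3"
    using card_cycles_same_signature(2)[of k] by (simp only: sig_multiplicity_def)
qed

end
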